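(* Assume that the space decomposition $\mathcal K=\sum_{i=1}^N\mathcal K_i$ satisfies the following two assumptions with positive constants $C_A$ and $C_S$. (SD) For every $v\in\mathcal K$ there exist $v_i\in\mathcal K_i$, $i=1,\dots,N$, such that $v=\sum_{i=1}^N v_i$ and $\sum_{i=1}^N\|v_i\|_A^2\le C_A\|v\|_A^2$. (SCS) For any $u_i\in\mathcal K_i$ and $v_j\in\mathcal K_j$ ($i,j=1,\dots,N$), $$\sum_{i=1}^N\sum_{j=i+1}^N(u_i,v_j)_A\le C_S^{1/2}\Big(\sum_{i=1}^N\|u_i\|_A^2\Big)^{1/2}\Big(\sum_{j=1}^N\|v_j\|_A^2\Big)^{1/2}.$$ Let $u$ be the minimizer of $E$ over $\mathcal K$, let $u^k\in\mathcal K$, and let $u^{k+1}$ be obtained from $u^k$ by one step of SSO with the inexact local solver (one preconditioned gradient step with preconditioner $D_i$ and line search). Then $$E(u^{k+1})-E(u)\le\rho\,\big[E(u^k)-E(u)\big],\qquad \rho=1-\frac{1}{1+C_A\Big[C_S^{1/2}+\tfrac12\big(\max_{1\le i\le N}\kappa(D_i^{-1}A_i)-1\big)\Big]^2}.$$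
   Context: $\mathcal H$ is a (real) Hilbert space with inner product $(\cdot,\cdot)$, $\mathcal V\subset\mathcal H$ is a closed subspace, and $A:\mathcal V\to\mathcal V$ is symmetric and positive definite (SPD) with respect to $(\cdot,\cdot)$; $(u,v)_A:=(Au,v)$ and $\|\cdot\|_A$ is the associated norm. $\mathcal P$ is another Hilbert space (inner product also denoted $(\cdot,\cdot)$), $B:\mathcal V\to\mathcal P$ is a bounded linear operator, and $\mathcal K=\ker(B)$. For a fixed $f\in\mathcal H$, $E(v)=\frac12\|v\|_A^2-(f,v)$ for $v\in\mathcal V$. The associated saddle point problem is assumed well posed, so that $E$ has a unique minimizer over $\mathcal K$. $\mathcal V=\mathcal V_1+\dots+\mathcal V_N$ with subspaces $\mathcal V_i\subset\mathcal V$ (finite-dimensional), and $\mathcal K_i=\mathcal V_i\cap\ker(B)$ are assumed to satisfy $\mathcal K=\mathcal K_1+\dots+\mathcal K_N$. Put $\mathcal P_i=\mathcal P\cap B(\mathcal V_i)$. Define $A_i:\mathcal V_i\to\mathcal V_i$ by $(A_iu_i,v_i)=(Au_i,v_i)$ for all $u_i,v_i\in\mathcal V_i$, and $B_i:\mathcal V_i\to\mathcal P_i$ by $(B_iu_i,q_i)=(Bu_i,q_i)$ for all $u_i\in\mathcal V_i$, $q_i\in\mathcal P_i$; $B_i^T:\mathcal P_i\to\mathcal V_i$ is its adjoint. $Q_i:\mathcal H\to\mathcal V_i$ is the $(\cdot,\cdot)$-orthogonal projection. $D_i$ is a given SPD operator on $\mathcal V_i$, and $\kappa(D_i^{-1}A_i)=\lambda_{\max}(D_i^{-1}A_i)/\lambda_{\min}(D_i^{-1}A_i)$.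 One step of SSO with the inexact local solver: given $u^k\in\mathcal K$, set $v_0=u^k$. For $i=1,\dots,N$: let $r_i=Q_i(f-Av_{i-1})$; let $(s_i,p_i)\in\mathcal V_i\times\mathcal P_i$ solve $D_is_i+B_i^Tp_i=r_i$, $B_is_i=0$; let $\alpha=\dfrac{(r_i,s_i)}{(As_i,s_i)}$, which minimizes $E(v_{i-1}+\alpha s_i)$ over $\alpha\in\mathbb R$ (if $s_i=0$ no update is made); set $e_i=\alpha s_i$ (with $e_i=0$ if $s_i=0$) and $v_i=v_{i-1}+e_i$. Finally $u^{k+1}=v_N$. *)

theory Defs
  imports "HOL-Analysis.Analysis"
begin

(* A linear subspace of a Hilbert space is a set W with "subspace W". Operators on subspaces are
   functions on the ambient type of which only the values on the subspace matter. *)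

definition linear_map_on ::
    "'a::real_vector set \<Rightarrow> 'b::real_vector set \<Rightarrow> ('a \<Rightarrow> 'b) \<Rightarrow> bool" where
  "linear_map_on W Z T \<longleftrightarrow>
     (\<forall>x\<in>W. T x \<in> Z) \<and>
     (\<forall>x\<in>W. \<forall>y\<in>W. T (x + y) = T x + T y) \<and>
     (\<forall>c. \<forall>x\<in>W. T (c *\<^sub>R x) = c *\<^sub>R T x)"

definition bounded_linear_map_on ::
    "'a::real_normed_vector set \<Rightarrow> ('a \<Rightarrow> 'b::real_normed_vector) \<Rightarrow> bool" where
  "bounded_linear_map_on W T \<longleftrightarrow>
     linear_map_on W UNIV T \<and> (\<exists>C. \<forall>x\<in>W. norm (T x) \<le> C * norm x)"

definition spd_on :: "'a::real_inner set \<Rightarrow> ('a \<Rightarrow> 'a) \<Rightarrow> bool" where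
  "spd_on W T \<longleftrightarrow>
     linear_map_on W W T \<and>
     (\<forall>x\<in>W. \<forall>y\<in>W. T x \<bullet> y = x \<bullet> T y) \<and>
     (\<forall>x\<in>W. x \<noteq> 0 \<longrightarrow> 0 < T x \<bullet> x)"

definition finite_dim :: "'a::real_vector set \<Rightarrow> bool" where
  "finite_dim W \<longleftrightarrow> (\<exists>b. finite b \<and> span b = W)"

definition kernel_on :: "'a set \<Rightarrow> ('a \<Rightarrow> 'b::zero) \<Rightarrow> 'a set" where
  "kernel_on W T = {x \<in> W. T x = 0}"

definition op_inner :: "('a::real_inner \<Rightarrow> 'a) \<Rightarrow> 'a \<Rightarrow> 'a \<Rightarrow> real" where
  "op_inner A u v = A u \<bullet> v"

definition op_norm :: "('a::real_inner \<Rightarrow> 'a) \<Rightarrow> 'a \<Rightarrow> real" where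
  "op_norm A v = sqrt (op_inner A v v)"

definition energy :: "('a::real_inner \<Rightarrow> 'a) \<Rightarrow> 'a \<Rightarrow> 'a \<Rightarrow> real" where
  "energy A f v = 1/2 * (op_norm A v)\<^sup>2 - f \<bullet> v"

(* The descriptions below denote uniquely determined elements when W and Z are
   finite-dimensional subspaces and the operators involved are linear on W. *)

definition orth_proj :: "'a::real_inner set \<Rightarrow> 'a \<Rightarrow> 'a" where
  "orth_proj W x = (THE w. w \<in> W \<and> (\<forall>y\<in>W. (x - w) \<bullet> y = 0))"

(* A_i = local_op A (V i), and B_i = local_op B (P_i) with P_i = B ` V i. *)
definition local_op :: "('a \<Rightarrow> 'b::real_inner) \<Rightarrow> 'b set \<Rightarrow> 'a \<Rightarrow> 'b" where
  "local_op T Z u = (THE w. w \<in> Z \<and> (\<forall>z\<in>Z. w \<bullet> z = T u \<bullet> z))"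

definition adjoint_on ::
    "'a::real_inner set \<Rightarrow> ('a \<Rightarrow> 'b::real_inner) \<Rightarrow> 'b \<Rightarrow> 'a" where
  "adjoint_on W T q = (THE w. w \<in> W \<and> (\<forall>x\<in>W. w \<bullet> x = q \<bullet> T x))"

definition eigenvalues_on :: "'a::real_vector set \<Rightarrow> ('a \<Rightarrow> 'a) \<Rightarrow> real set" where
  "eigenvalues_on W T = {l. \<exists>x\<in>W. x \<noteq> 0 \<and> T x = l *\<^sub>R x}"

(* The zero space has no eigenvalues; there every operator is the identity, whence the value 1. *)
definition spectral_cond :: "'a::real_vector set \<Rightarrow> ('a \<Rightarrow> 'a) \<Rightarrow> real" where
  "spectral_cond W T =
     (if W = {0} then 1 else Max (eigenvalues_on W T) / Min (eigenvalues_on W T))"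

definition precond_cond ::
    "('a::real_inner \<Rightarrow> 'a) \<Rightarrow> 'a set \<Rightarrow> ('a \<Rightarrow> 'a) \<Rightarrow> real" where
  "precond_cond A W D = spectral_cond W (\<lambda>x. inv_into W D (local_op A W x))"

(* (s, p) solves the local saddle point problem on W with residual r, the multiplier
   space being B ` W (the second Hilbert space is the whole type 'b). *)
definition local_saddle_solution ::
    "('a::real_inner \<Rightarrow> 'b::real_inner) \<Rightarrow> 'a set \<Rightarrow> ('a \<Rightarrow> 'a) \<Rightarrow> 'a \<Rightarrow> 'a \<Rightarrow> 'b \<Rightarrow> bool" where
  "local_saddle_solution B W D r s p \<longleftrightarrow>
     (let Z = B ` W; B\<^sub>W = local_op B Z in
        s \<in> W \<and> p \<in> Z \<and> D s + adjoint_on W B\<^sub>W p = r \<and> B\<^sub>W s = 0)"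

definition line_search_update :: "('a::real_inner \<Rightarrow> 'a) \<Rightarrow> 'a \<Rightarrow> 'a \<Rightarrow> 'a" where
  "line_search_update A r s = (if s = 0 then 0 else ((r \<bullet> s) / (A s \<bullet> s)) *\<^sub>R s)"

definition inexact_sso_step ::
    "nat \<Rightarrow> (nat \<Rightarrow> 'a::real_inner set) \<Rightarrow> ('a \<Rightarrow> 'a) \<Rightarrow> ('a \<Rightarrow> 'b::real_inner) \<Rightarrow>
     (nat \<Rightarrow> 'a \<Rightarrow> 'a) \<Rightarrow> 'a \<Rightarrow> 'a \<Rightarrow> 'a \<Rightarrow> bool" where
  "inexact_sso_step N V A B D f u_old u_new \<longleftrightarrow>
     (\<exists>v s p. v 0 = u_old \<and> v N = u_new \<and>
        (\<forall>i\<in>{1..N}.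
           let r = orth_proj (V i) (f - A (v (i - 1))) in
             local_saddle_solution B (V i) (D i) r (s i) (p i) \<and>
             v i = v (i - 1) + line_search_update A r (s i)))"

end

theory Submission
  imports Defs
begin

text \<open>
  If \<open>a A \<le> D \<le> b A\<close> on a local space, with \<open>b = \<kappa> a\<close>, the exact line search
  gives \<open>\<alpha> \<ge> a\<close>, and testing with \<open>w\<close> in the local kernel bounds the local residual
  \<open>(f - A v\<^sub>i, w) = ((D - \<alpha> A) s, w)\<close> by \<open>(b - a) / 2 * \<parallel>s\<parallel> \<parallel>w\<parallel> \<le> (\<kappa> - 1) / 2 * \<parallel>e\<^sub>i\<parallel> \<parallel>w\<parallel>\<close>.
  Each step lowers the energy by exactly \<open>\<parallel>e\<^sub>i\<parallel>\<^sup>2 / 2\<close>. Decomposing the final error stably and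
  telescoping the residual, these local bounds and the strengthened Cauchy-Schwarz inequality
  control the final energy error by a multiple of the energy decrease, which is the contraction.
\<close>

section \<open>Linear maps on finite-dimensional subspaces\<close>

lemma linear_map_on_mem: "linear_map_on W Z T \<Longrightarrow> x \<in> W \<Longrightarrow> T x \<in> Z"
  by (simp add: linear_map_on_def)

lemma linear_map_on_add: "linear_map_on W Z T \<Longrightarrow> x \<in> W \<Longrightarrow> y \<in> W \<Longrightarrow> T (x + y) = T x + T y"
  by (simp add: linear_map_on_def)

lemma linear_map_on_scale: "linear_map_on W Z T \<Longrightarrow> x \<in> W \<Longrightarrow> T (c *\<^sub>R x) = c *\<^sub>R T x"
  by (simp add: linear_map_on_def)

lemma linear_map_on_zero: "linear_map_on W Z T \<Longrightarrow> subspace W \<Longrightarrow> T 0 = 0"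
  using linear_map_on_scale[of W Z T 0 0] subspace_0[of W] by simp

lemma linear_map_on_diff:
  assumes "linear_map_on W Z T" "subspace W" "x \<in> W" "y \<in> W"
  shows "T (x - y) = T x - T y"
proof -
  have "T (x + (-1) *\<^sub>R y) = T x + (-1) *\<^sub>R T y"
    using assms by (metis linear_map_on_add linear_map_on_scale subspace_scale)
  then show ?thesis by simp
qed

lemma linear_map_on_sum:
  assumes "linear_map_on W Z T" "subspace W" "\<And>i. i \<in> I \<Longrightarrow> g i \<in> W"
  shows "T (\<Sum>i\<in>I. g i) = (\<Sum>i\<in>I. T (g i))"
  using assms(3)
proof (induction I rule: infinite_finite_induct)
  case (insert i I)
  then have "(\<Sum>i\<in>I. g i) \<in> W"
    using assms(2) by (intro subspace_sum) auto
  with insert show ?case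
    using assms(1) by (simp add: linear_map_on_add)
qed (use linear_map_on_zero[OF assms(1,2)] in auto)

lemma finite_dim_subspace: "finite_dim W \<Longrightarrow> subspace W"
  by (auto simp: finite_dim_def)

text \<open>Linearity holds only on \<open>W\<close>, so the argument goes through minimality of
  spans: the points of \<open>W\<close> sent into the span of the image of \<open>b\<close> form a
  subspace that contains \<open>b\<close>.\<close>

lemma finite_dim_image:
  assumes T: "linear_map_on W Z T" and "finite_dim W"
  shows "finite_dim (T ` W)"
proof -
  obtain b where b: "finite b" "span b = W"
    using assms(2) by (auto simp: finite_dim_def)
  have sub: "subspace W"
    using b by auto
  have "subspace {x \<in> W. T x \<in> span (T ` b)}"
    unfolding subspace_def
    using sub linear_map_on_zero[OF T sub]
    by (auto simp: linear_map_on_add[OF T] linear_map_on_scale[OF T] subspace_0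
        subspace_add subspace_scale span_zero span_add span_scale)
  moreover have "b \<subseteq> {x \<in> W. T x \<in> span (T ` b)}"
    using b by (auto intro: span_base)
  ultimately have "T ` W \<subseteq> span (T ` b)"
    using span_minimal[of b] b by blast
  moreover have "subspace (T ` W)"
    unfolding subspace_def
  proof (intro conjI ballI allI)
    show "0 \<in> T ` W"
      using linear_map_on_zero[OF T sub] subspace_0[OF sub] by (metis imageI)
  next
    fix x y assume "x \<in> T ` W" "y \<in> T ` W"
    then show "x + y \<in> T ` W"
      using linear_map_on_add[OF T] subspace_add[OF sub] by (metis (no_types, lifting) image_iff)
  next
    fix c x assume "x \<in> T ` W"
    then show "c *\<^sub>R x \<in> T ` W"
      using linear_map_on_scale[OF T] subspace_scale[OF sub] by (metis (no_types, lifting) image_iff)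
  qed
  moreover have "T ` b \<subseteq> T ` W"
    using b span_superset by blast
  ultimately have "span (T ` b) = T ` W"
    by (simp add: span_minimal subset_antisym)
  then show ?thesis
    using b(1) by (auto simp: finite_dim_def)
qed

section \<open>Orthonormal bases and Riesz representation\<close>

lemma finite_dim_orthonormal_basis:
  fixes W :: "'a::real_inner set"
  assumes "finite_dim W"
  obtains E where "finite E" "span E = W" "pairwise orthogonal E" "\<And>e. e \<in> E \<Longrightarrow> norm e = 1"
proof -
  obtain b where "finite b" "span b = W"
    using assms by (auto simp: finite_dim_def)
  then obtain C where C: "finite C" "span C = W" "pairwise orthogonal C"
    using basis_orthogonal[of b] by blast
  \<comment> \<open>The orthogonal spanning set may contain 0, which cannot be normalized; dropping
    it leaves the span unchanged.\<close>
  define E where "E = (\<lambda>x. (1 / norm x) *\<^sub>R x) ` (C - {0})"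
  have "span E = span (C - {0})"
    unfolding E_def using C(1) by (intro span_image_scale) auto
  also have "\<dots> = W"
    using C(2) by simp
  finally have "span E = W" .
  moreover have "pairwise orthogonal E"
    using C(3) unfolding E_def pairwise_def by (auto simp: orthogonal_def)
  moreover have "finite E" "\<And>e. e \<in> E \<Longrightarrow> norm e = 1"
    using C(1) by (auto simp: E_def split: if_splits)
  ultimately show thesis
    by (intro that)
qed

text \<open>The vectors that equal their own expansion form a subspace, and orthonormality puts
  every member of \<open>E\<close> in it, so it contains the span.\<close>

lemma orthonormal_expansion:
  fixes E :: "'a::real_inner set"
  assumes "finite E" "pairwise orthogonal E" "\<And>e. e \<in> E \<Longrightarrow> norm e = 1" "x \<in> span E"
  shows "x = (\<Sum>e\<in>E. (x \<bullet> e) *\<^sub>R e)"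
proof -
  have "subspace {x. (\<Sum>e\<in>E. (x \<bullet> e) *\<^sub>R e) = x}"
    by (auto simp: subspace_def inner_add_left scaleR_add_left sum.distrib
        simp flip: scaleR_scaleR scaleR_sum_right)
  moreover have "E \<subseteq> {x. (\<Sum>e\<in>E. (x \<bullet> e) *\<^sub>R e) = x}"
  proof
    fix d assume d: "d \<in> E"
    have "(\<Sum>e\<in>E. (d \<bullet> e) *\<^sub>R e) = (\<Sum>e\<in>E. if e = d then d else 0)"
      using assms(2,3) d
      by (intro sum.cong) (auto simp: pairwise_def orthogonal_def dot_square_norm)
    then show "d \<in> {x. (\<Sum>e\<in>E. (x \<bullet> e) *\<^sub>R e) = x}"
      using assms(1) d by simp
  qed
  ultimately have "span E \<subseteq> {x. (\<Sum>e\<in>E. (x \<bullet> e) *\<^sub>R e) = x}"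
    by (rule span_minimal[rotated])
  then show ?thesis
    using assms(4) by auto
qed

text \<open>The representer is the combination of the basis vectors with the values of
  \<open>\<phi>\<close> as coefficients. This result makes the definite descriptions in
  \<open>orth_proj\<close>, \<open>local_op\<close> and \<open>adjoint_on\<close> denote.\<close>

lemma finite_dim_riesz:
  fixes W :: "'a::real_inner set" and \<phi> :: "'a \<Rightarrow> real"
  assumes "finite_dim W" and \<phi>: "linear_map_on W UNIV \<phi>"
  shows "\<exists>!w. w \<in> W \<and> (\<forall>x\<in>W. w \<bullet> x = \<phi> x)"
proof -
  obtain E where E: "finite E" "span E = W" "pairwise orthogonal E" "\<And>e. e \<in> E \<Longrightarrow> norm e = 1"
    using finite_dim_orthonormal_basis[OF assms(1)] by blast
  have sub: "subspace W"
    using assms(1) by (rule finite_dim_subspace)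
  have EW: "e \<in> W" if "e \<in> E" for e
    using that E(2) span_base by blast
  define w where "w = (\<Sum>e\<in>E. \<phi> e *\<^sub>R e)"
  have w: "w \<in> W"
    unfolding w_def by (intro subspace_sum sub subspace_scale EW)
  have "w \<bullet> x = \<phi> x" if "x \<in> W" for x
  proof -
    have "\<phi> x = \<phi> (\<Sum>e\<in>E. (x \<bullet> e) *\<^sub>R e)"
      using orthonormal_expansion[OF E(1,3,4)] that E(2) by metis
    also have "\<dots> = (\<Sum>e\<in>E. (x \<bullet> e) *\<^sub>R \<phi> e)"
      using sub EW by (subst linear_map_on_sum[OF \<phi> sub])
        (auto simp: linear_map_on_scale[OF \<phi>] subspace_scale)
    also have "\<dots> = w \<bullet> x"
      by (simp add: w_def inner_sum_left inner_commute[of x] mult.commute)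
    finally show ?thesis ..
  qed
  moreover have "z = w" if "z \<in> W" "\<forall>x\<in>W. z \<bullet> x = \<phi> x" for z
  proof -
    have "z - w \<in> W"
      using that w sub by (simp add: subspace_diff)
    then have "(z - w) \<bullet> (z - w) = 0"
      using that calculation by (simp add: inner_diff_left)
    then show ?thesis by simp
  qed
  ultimately show ?thesis
    using w by blast
qed

lemma linear_map_on_inner_compose:
  "linear_map_on W Z T \<Longrightarrow> linear_map_on W UNIV (\<lambda>x. q \<bullet> T x)"
  by (auto simp: linear_map_on_def inner_add_right)

lemma linear_map_on_inner: "linear_map_on W UNIV (\<lambda>x. q \<bullet> x)"
  by (auto simp: linear_map_on_def inner_add_right)

lemma
  assumes "finite_dim W"
  shows orth_proj_mem: "orth_proj W x \<in> W"
    and orth_proj_inner: "y \<in> W \<Longrightarrow> orth_proj W x \<bullet> y = x \<bullet> y"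
proof -
  have "\<exists>!w. w \<in> W \<and> (\<forall>y\<in>W. (x - w) \<bullet> y = 0)"
  proof -
    have "(x - w) \<bullet> y = 0 \<longleftrightarrow> w \<bullet> y = x \<bullet> y" for w y
      by (auto simp: inner_diff_left)
    then show ?thesis
      using finite_dim_riesz[OF assms linear_map_on_inner[of W x]] by simp
  qed
  from theI'[OF this] show "orth_proj W x \<in> W" "y \<in> W \<Longrightarrow> orth_proj W x \<bullet> y = x \<bullet> y"
    unfolding orth_proj_def[symmetric] by (auto simp: inner_diff_left)
qed

lemma
  assumes "finite_dim W"
  shows local_op_mem: "local_op T W x \<in> W"
    and local_op_inner: "y \<in> W \<Longrightarrow> local_op T W x \<bullet> y = T x \<bullet> y"
proof -
  have "\<exists>!w. w \<in> W \<and> (\<forall>y\<in>W. w \<bullet> y = T x \<bullet> y)"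
    using finite_dim_riesz[OF assms linear_map_on_inner[of W "T x"]] by simp
  from theI'[OF this] show "local_op T W x \<in> W" "y \<in> W \<Longrightarrow> local_op T W x \<bullet> y = T x \<bullet> y"
    unfolding local_op_def[symmetric] by auto
qed

lemma adjoint_on_inner:
  assumes "finite_dim W" "linear_map_on W Z T" "x \<in> W"
  shows "adjoint_on W T q \<bullet> x = q \<bullet> T x"
  using theI'[OF finite_dim_riesz[OF assms(1) linear_map_on_inner_compose[OF assms(2), of q]]] assms(3)
  unfolding adjoint_on_def[symmetric] by auto

text \<open>Since the multiplier space is the image of the local space, the local constraint
  operator is the restriction of \<open>B\<close> itself; a vanishing local constraint then means
  membership in the kernel of \<open>B\<close>.\<close>

lemma local_op_range:
  assumes "subspace Z" "T x \<in> Z"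
  shows "local_op T Z x = T x"
  unfolding local_op_def
proof (rule the_equality)
  fix w assume w: "w \<in> Z \<and> (\<forall>z\<in>Z. w \<bullet> z = T x \<bullet> z)"
  then have "w - T x \<in> Z"
    using assms by (simp add: subspace_diff)
  then have "(w - T x) \<bullet> (w - T x) = 0"
    using w by (simp add: inner_diff_left)
  then show "w = T x" by simp
qed (use assms in auto)

section \<open>Continuity and compactness on finite-dimensional subspaces\<close>

lemma continuous_on_linear_map_on:
  fixes W :: "'a::real_inner set" and T :: "'a \<Rightarrow> 'b::real_normed_vector"
  assumes "finite_dim W" and T: "linear_map_on W Z T"
  shows "continuous_on W T"
proof -
  obtain E where E: "finite E" "span E = W" "pairwise orthogonal E" "\<And>e. e \<in> E \<Longrightarrow> norm e = 1"
    using finite_dim_orthonormal_basis[OF assms(1)] by blast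
  have sub: "subspace W"
    using assms(1) by (rule finite_dim_subspace)
  have EW: "e \<in> W" if "e \<in> E" for e
    using that E(2) span_base by blast
  \<comment> \<open>On \<open>W\<close> the map is a finite combination of fixed vectors with the
    continuous coefficients \<open>x \<bullet> e\<close>.\<close>
  have "T x = (\<Sum>e\<in>E. (x \<bullet> e) *\<^sub>R T e)" if "x \<in> W" for x
  proof -
    have "T x = T (\<Sum>e\<in>E. (x \<bullet> e) *\<^sub>R e)"
      using orthonormal_expansion[OF E(1,3,4)] that E(2) by metis
    also have "\<dots> = (\<Sum>e\<in>E. (x \<bullet> e) *\<^sub>R T e)"
      using sub EW by (subst linear_map_on_sum[OF T sub])
        (auto simp: linear_map_on_scale[OF T] subspace_scale)
    finally show ?thesis .
  qed
  moreover have "continuous_on W (\<lambda>x. \<Sum>e\<in>E. (x \<bullet> e) *\<^sub>R T e)"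
    by (intro continuous_intros)
  ultimately show ?thesis
    by (metis (no_types, lifting) continuous_on_cong)
qed

text \<open>Heine-Borel may fail in the ambient space, so compactness is built up one vector at a
  time: adding \<open>d\<close> gives the continuous image of an interval times the previous compact
  set.\<close>

lemma compact_box_combinations:
  fixes E :: "'a::real_normed_vector set"
  assumes "finite E"
  shows "compact {\<Sum>e\<in>E. c e *\<^sub>R e |c. \<forall>e\<in>E. \<bar>c e\<bar> \<le> (1::real)}"
  using assms
proof (induction E)
  case empty
  then show ?case by simp
next
  case (insert d E)
  let ?S = "\<lambda>E. {\<Sum>e\<in>E. c e *\<^sub>R e |c. \<forall>e\<in>E. \<bar>c e\<bar> \<le> (1::real)}"
  have "?S (insert d E) = (\<lambda>(t, y). t *\<^sub>R d + y) ` ({-1..1} \<times> ?S E)"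
  proof (intro equalityI subsetI)
    fix x assume "x \<in> ?S (insert d E)"
    then obtain c where "x = (\<Sum>e\<in>insert d E. c e *\<^sub>R e)" "\<forall>e\<in>insert d E. \<bar>c e\<bar> \<le> 1"
      by blast
    then show "x \<in> (\<lambda>(t, y). t *\<^sub>R d + y) ` ({-1..1} \<times> ?S E)"
      using insert.hyps by (intro image_eqI[of _ _ "(c d, \<Sum>e\<in>E. c e *\<^sub>R e)"]) (auto simp: abs_le_iff)
  next
    fix x assume "x \<in> (\<lambda>(t, y). t *\<^sub>R d + y) ` ({-1..1} \<times> ?S E)"
    then obtain t c where tc: "x = t *\<^sub>R d + (\<Sum>e\<in>E. c e *\<^sub>R e)" "\<bar>t\<bar> \<le> 1" "\<forall>e\<in>E. \<bar>c e\<bar> \<le> 1"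
      by (auto simp: abs_le_iff)
    have "(\<Sum>e\<in>E. c e *\<^sub>R e) = (\<Sum>e\<in>E. (c(d := t)) e *\<^sub>R e)"
      using insert.hyps by (intro sum.cong) auto
    with tc have "x = (\<Sum>e\<in>insert d E. (c(d := t)) e *\<^sub>R e)" "\<forall>e\<in>insert d E. \<bar>(c(d := t)) e\<bar> \<le> 1"
      using insert.hyps by auto
    then show "x \<in> ?S (insert d E)" by blast
  qed
  moreover have "compact ((\<lambda>(t, y). t *\<^sub>R d + y) ` ({-1..1} \<times> ?S E))"
    using insert.IH
    by (intro compact_continuous_image compact_Times)
      (auto simp: case_prod_unfold intro!: continuous_intros)
  ultimately show ?case by simp
qed

text \<open>By Cauchy-Schwarz a unit vector has coordinates at most 1 in absolute value, so the
  sphere is a closed part of the compact box.\<close>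

lemma compact_unit_sphere_finite_dim:
  fixes W :: "'a::real_inner set"
  assumes "finite_dim W"
  shows "compact {x \<in> W. norm x = 1}"
proof -
  obtain E where E: "finite E" "span E = W" "pairwise orthogonal E" "\<And>e. e \<in> E \<Longrightarrow> norm e = 1"
    using finite_dim_orthonormal_basis[OF assms] by blast
  let ?S = "{\<Sum>e\<in>E. c e *\<^sub>R e |c. \<forall>e\<in>E. \<bar>c e\<bar> \<le> (1::real)}"
  have "?S \<subseteq> W"
    unfolding E(2)[symmetric] by (auto intro!: span_sum span_scale intro: span_base)
  moreover have "x \<in> ?S" if "x \<in> W" "norm x = 1" for x
  proof -
    have "x = (\<Sum>e\<in>E. (x \<bullet> e) *\<^sub>R e)"
      using orthonormal_expansion[OF E(1,3,4)] that E(2) by blast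
    moreover have "\<bar>x \<bullet> e\<bar> \<le> 1" if "e \<in> E" for e
      using Cauchy_Schwarz_ineq2[of x e] E(4)[OF that] \<open>norm x = 1\<close> by simp
    ultimately show ?thesis by blast
  qed
  ultimately have "{x \<in> W. norm x = 1} = ?S \<inter> {x. norm x = 1}"
    by auto
  moreover have "compact (?S \<inter> {x. norm x = 1})"
    by (intro compact_Int_closed compact_box_combinations E(1) closed_Collect_eq continuous_intros)
  ultimately show ?thesis
    by simp
qed

section \<open>Spectral bounds for a preconditioned operator\<close>

text \<open>For small \<open>t\<close> of suitable sign a nonzero linear term would win. This is the
  first-order condition behind \<open>symmetric_semidefinite_null\<close> and
  \<open>energy_minimizer_variational\<close>.\<close>

lemma quadratic_nonneg_imp_zero:
  fixes p q :: real
  assumes "\<And>t. 0 \<le> t * p + t\<^sup>2 * q"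
  shows "p = 0"
proof (rule ccontr)
  assume "p \<noteq> 0"
  \<comment> \<open>\<open>m\<close> is positive and exceeds \<open>q\<close>, so the choice
    \<open>t = - p / m\<close> makes the quadratic negative.\<close>
  define m where "m = \<bar>q\<bar> + 1"
  have m: "m > 0" "q < m"
    by (auto simp: m_def)
  have "(- p / m) * p + (- p / m)\<^sup>2 * q = (p\<^sup>2 / m\<^sup>2) * (q - m)"
    using m by (simp add: field_simps power2_eq_square)
  also have "\<dots> < 0"
    using m \<open>p \<noteq> 0\<close> by (intro mult_pos_neg) auto
  finally show False
    using assms[of "- p / m"] by linarith
qed

lemma spd_onD:
  assumes "spd_on W T"
  shows spd_on_linear: "linear_map_on W W T"
    and spd_on_sym: "x \<in> W \<Longrightarrow> y \<in> W \<Longrightarrow> T x \<bullet> y = T y \<bullet> x"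
    and spd_on_pos: "x \<in> W \<Longrightarrow> x \<noteq> 0 \<Longrightarrow> 0 < T x \<bullet> x"
  using assms by (auto simp: spd_on_def inner_commute)

lemma spd_on_nonneg: "spd_on W T \<Longrightarrow> x \<in> W \<Longrightarrow> 0 \<le> T x \<bullet> x"
  by (cases "x = 0") (auto dest: spd_on_pos intro: less_imp_le)

text \<open>\<open>x\<close> minimizes the form of \<open>G\<close> over \<open>W\<close>, so the
  derivative of the form at \<open>x\<close> vanishes in every direction; the direction
  \<open>G x\<close> gives twice the squared norm of \<open>G x\<close>.\<close>

lemma symmetric_semidefinite_null:
  assumes W: "subspace W" and G: "linear_map_on W W G"
    and sym: "\<And>x y. x \<in> W \<Longrightarrow> y \<in> W \<Longrightarrow> G x \<bullet> y = G y \<bullet> x"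
    and psd: "\<And>y. y \<in> W \<Longrightarrow> 0 \<le> G y \<bullet> y"
    and x: "x \<in> W" "G x \<bullet> x = 0"
  shows "G x = 0"
proof -
  define y where "y = G x"
  have y: "y \<in> W"
    using linear_map_on_mem[OF G] x by (simp add: y_def)
  have "0 \<le> t * (2 * (G x \<bullet> y)) + t\<^sup>2 * (G y \<bullet> y)" for t
  proof -
    have "G (x + t *\<^sub>R y) = G x + t *\<^sub>R G y"
      using x y W by (simp add: linear_map_on_add[OF G] linear_map_on_scale[OF G] subspace_scale)
    then have "G (x + t *\<^sub>R y) \<bullet> (x + t *\<^sub>R y) = t * (2 * (G x \<bullet> y)) + t\<^sup>2 * (G y \<bullet> y)"
      using sym[OF x(1) y] x(2)
      by (simp add: inner_add_left inner_add_right algebra_simps power2_eq_square)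
    moreover have "x + t *\<^sub>R y \<in> W"
      using x y W by (simp add: subspace_add subspace_scale)
    ultimately show ?thesis
      using psd by metis
  qed
  then have "2 * (G x \<bullet> y) = 0"
    by (rule quadratic_nonneg_imp_zero)
  then show ?thesis
    by (simp add: y_def)
qed

text \<open>A maximizer of the quotient of the two forms over the compact unit sphere makes
  \<open>l D - S\<close> positive semidefinite with \<open>x\<close> as a null vector of its form,
  so \<open>symmetric_semidefinite_null\<close> turns \<open>x\<close> into an eigenvector of the
  pencil. \<open>S\<close> may be indefinite, which lets the minimum be obtained from
  \<open>- S\<close>.\<close>

lemma max_rayleigh_quotient:
  assumes fin: "finite_dim W" and "W \<noteq> {0}" and D: "spd_on W D"
    and S: "linear_map_on W W S"
    and sym: "\<And>x y. x \<in> W \<Longrightarrow> y \<in> W \<Longrightarrow> S x \<bullet> y = S y \<bullet> x"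
  obtains l x where "x \<in> W" "x \<noteq> 0" "S x = l *\<^sub>R D x" "\<And>y. y \<in> W \<Longrightarrow> S y \<bullet> y \<le> l * (D y \<bullet> y)"
proof -
  have W: "subspace W"
    using fin by (rule finite_dim_subspace)
  note Dl = spd_on_linear[OF D]
  let ?K = "{x \<in> W. norm x = 1}"
  let ?q = "\<lambda>x. (S x \<bullet> x) / (D x \<bullet> x)"
  obtain z where "z \<in> W" "z \<noteq> 0"
    using assms(2) subspace_0[OF W] by blast
  then have "(1 / norm z) *\<^sub>R z \<in> ?K"
    using W by (simp add: subspace_scale)
  then have "?K \<noteq> {}" by blast
  moreover have "continuous_on ?K ?q"
  proof (intro continuous_on_divide continuous_on_inner continuous_on_id)
    show "continuous_on ?K S" "continuous_on ?K D"
      using continuous_on_linear_map_on[OF fin S] continuous_on_linear_map_on[OF fin Dl]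
      by (auto intro: continuous_on_subset)
    show "\<forall>x\<in>?K. D x \<bullet> x \<noteq> 0"
      using spd_on_pos[OF D] by force
  qed
  ultimately obtain x where x: "x \<in> ?K" "\<And>y. y \<in> ?K \<Longrightarrow> ?q y \<le> ?q x"
    using continuous_attains_sup[OF compact_unit_sphere_finite_dim[OF fin]] by blast
  define l where "l = ?q x"
  have le: "S y \<bullet> y \<le> l * (D y \<bullet> y)" if "y \<in> W" for y
  proof (cases "y = 0")
    case False
    define c where "c = 1 / norm y"
    have c: "c > 0"
      using False by (simp add: c_def)
    have "c *\<^sub>R y \<in> ?K"
      using that W False by (simp add: subspace_scale c_def)
    then have "?q (c *\<^sub>R y) \<le> l"
      using x(2) l_def by blast
    then have "?q y \<le> l"
      using c that by (simp add: linear_map_on_scale[OF S] linear_map_on_scale[OF Dl])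
    then show ?thesis
      using spd_on_pos[OF D that False] by (simp add: divide_le_eq)
  qed (use linear_map_on_zero[OF S W] linear_map_on_zero[OF Dl W] in simp)
  let ?G = "\<lambda>y. l *\<^sub>R D y - S y"
  have "?G x = 0"
  proof (rule symmetric_semidefinite_null[OF W, where G = ?G])
    show "linear_map_on W W ?G"
      using W linear_map_on_mem[OF S] linear_map_on_mem[OF Dl]
      by (auto simp: linear_map_on_def subspace_diff subspace_scale linear_map_on_add[OF S]
          linear_map_on_add[OF Dl] linear_map_on_scale[OF S] linear_map_on_scale[OF Dl] algebra_simps)
    show "?G x \<bullet> x = 0"
      using x(1) spd_on_pos[OF D, of x] by (force simp: l_def inner_diff_left)
    show "?G y \<bullet> z = ?G z \<bullet> y" if "y \<in> W" "z \<in> W" for y z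
      using sym[OF that] spd_on_sym[OF D that] by (simp add: inner_diff_left)
    show "0 \<le> ?G y \<bullet> y" if "y \<in> W" for y
      using le[OF that] by (simp add: inner_diff_left)
    show "x \<in> W"
      using x(1) by simp
  qed
  then show thesis
    using x(1) le that[of x l] by force
qed

section \<open>Invertibility, spectrum and condition number of the preconditioned operator\<close>

lemma spd_on_inj:
  assumes "spd_on W D" "subspace W"
  shows "inj_on D W"
proof (rule inj_onI)
  fix x y assume xy: "x \<in> W" "y \<in> W" "D x = D y"
  then have "D (x - y) \<bullet> (x - y) = 0"
    using linear_map_on_diff[OF spd_on_linear[OF assms(1)] assms(2)] by simp
  then show "x = y"
    using spd_on_pos[OF assms(1), of "x - y"] xy assms(2) by (force simp: subspace_diff)
qed

text \<open>The part \<open>z\<close> of \<open>y\<close> orthogonal to the range satisfies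
  \<open>z \<bullet> D z = 0\<close>, so definiteness kills it. With \<open>spd_on_inj\<close> this
  makes \<open>inv_into W D\<close> a true inverse on \<open>W\<close>.\<close>

lemma spd_on_surj:
  assumes D: "spd_on W D" and fin: "finite_dim W"
  shows "D ` W = W"
proof (intro equalityI subsetI)
  fix y assume y: "y \<in> W"
  have DW: "finite_dim (D ` W)"
    using finite_dim_image[OF spd_on_linear[OF D] fin] .
  have sub: "D ` W \<subseteq> W"
    using linear_map_on_mem[OF spd_on_linear[OF D]] by blast
  define z where "z = y - orth_proj (D ` W) y"
  have "orth_proj (D ` W) y \<in> D ` W"
    by (rule orth_proj_mem[OF DW])
  then have zW: "z \<in> W"
    using sub y finite_dim_subspace[OF fin] by (auto simp: z_def subspace_diff)
  then have "z \<bullet> D z = 0"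
    using orth_proj_inner[OF DW, of "D z" y] by (simp add: z_def inner_diff_left)
  then have "z = 0"
    using spd_on_pos[OF D zW] by (force simp: inner_commute)
  then show "y \<in> D ` W"
    using \<open>orth_proj (D ` W) y \<in> D ` W\<close> by (simp add: z_def)
qed (use linear_map_on_mem[OF spd_on_linear[OF D]] in blast)

text \<open>Eigenvectors of the pencil \<open>S - l D\<close> for distinct \<open>l\<close> are \<open>D\<close>-orthogonal, hence independent.\<close>
lemma finite_pencil_eigenvalues:
  assumes fin: "finite_dim W" and D: "spd_on W D"
    and sym: "\<And>x y. x \<in> W \<Longrightarrow> y \<in> W \<Longrightarrow> S x \<bullet> y = S y \<bullet> x"
  shows "finite {l. \<exists>x\<in>W. x \<noteq> 0 \<and> S x = l *\<^sub>R D x}" (is "finite ?L")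
proof -
  obtain b where b: "finite b" "span b = W"
    using fin by (auto simp: finite_dim_def)
  obtain g where g: "\<And>l. l \<in> ?L \<Longrightarrow> g l \<in> W \<and> g l \<noteq> 0 \<and> S (g l) = l *\<^sub>R D (g l)"
    using bchoice[of ?L "\<lambda>l x. x \<in> W \<and> x \<noteq> 0 \<and> S x = l *\<^sub>R D x"] by blast
  have orth: "D (g l) \<bullet> g m = 0" if "l \<in> ?L" "m \<in> ?L" "l \<noteq> m" for l m
  proof -
    have "l * (D (g l) \<bullet> g m) = S (g l) \<bullet> g m"
      using g[OF that(1)] by simp
    also have "\<dots> = S (g m) \<bullet> g l"
      using g[OF that(1)] g[OF that(2)] sym by blast
    also have "\<dots> = m * (D (g l) \<bullet> g m)"
      using g[OF that(1)] g[OF that(2)] spd_on_sym[OF D, of "g m" "g l"] by simp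
    finally show ?thesis
      using that(3) by simp
  qed
  have pos: "D (g l) \<bullet> g l > 0" if "l \<in> ?L" for l
    using g[OF that] spd_on_pos[OF D] by blast
  have inj: "inj_on g ?L"
  proof (rule inj_onI)
    fix l m assume lm: "l \<in> ?L" "m \<in> ?L" "g l = g m"
    then show "l = m"
      using orth[OF lm(1,2)] pos[OF lm(1)] by fastforce
  qed
  have "independent (g ` ?L)"
    unfolding dependent_def
  proof (intro notI, elim bexE)
    fix x assume x: "x \<in> g ` ?L" "x \<in> span (g ` ?L - {x})"
    then obtain l where l: "l \<in> ?L" "x = g l" by blast
    have "span (g ` ?L - {x}) \<subseteq> {y. D x \<bullet> y = 0}"
    proof (rule span_minimal)
      show "g ` ?L - {x} \<subseteq> {y. D x \<bullet> y = 0}"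
        using orth l by blast
      show "subspace {y. D x \<bullet> y = 0}"
        by (auto simp: subspace_def inner_add_right)
    qed
    then show False
      using x(2) pos[OF l(1)] l(2) by auto
  qed
  moreover have "g ` ?L \<subseteq> span b"
    using g b(2) by blast
  ultimately have "finite (g ` ?L)"
    by (rule independent_span_bound[OF b(1), THEN conjunct1])
  then show ?thesis
    using inj by (rule finite_imageD)
qed

lemma spd_on_local_op:
  assumes "spd_on VV A" "W \<subseteq> VV" "finite_dim W"
  shows "spd_on W (local_op A W)"
proof -
  let ?L = "local_op A W"
  note A = spd_on_linear[OF assms(1)] and W = finite_dim_subspace[OF assms(3)]
  note mem = local_op_mem[OF assms(3), of A] and L = local_op_inner[OF assms(3), of _ A]
  have eq: "y = z" if "y \<in> W" "z \<in> W" "\<And>w. w \<in> W \<Longrightarrow> y \<bullet> w = z \<bullet> w" for y z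
  proof -
    have "(y - z) \<bullet> (y - z) = 0"
      using that(3)[of "y - z"] that(1,2) W by (simp add: subspace_diff inner_diff_left)
    then show ?thesis by simp
  qed
  have "?L (x + y) = ?L x + ?L y" if "x \<in> W" "y \<in> W" for x y
    using that assms(2) W mem
    by (intro eq) (auto simp: L subspace_add inner_add_left linear_map_on_add[OF A] subset_iff)
  moreover have "?L (c *\<^sub>R x) = c *\<^sub>R ?L x" if "x \<in> W" for c x
    using that assms(2) W mem
    by (intro eq) (auto simp: L subspace_scale linear_map_on_scale[OF A] subset_iff)
  ultimately have "linear_map_on W W ?L"
    using mem by (simp add: linear_map_on_def)
  moreover have "?L x \<bullet> y = x \<bullet> ?L y" if "x \<in> W" "y \<in> W" for x y
    using that assms(2) spd_on_sym[OF assms(1), of x y] by (auto simp: L inner_commute[of x])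
  moreover have "?L x \<bullet> x > 0" if "x \<in> W" "x \<noteq> 0" for x
    using that assms(2) spd_on_pos[OF assms(1), of x] by (auto simp: L)
  ultimately show ?thesis
    unfolding spd_on_def by blast
qed

text \<open>The largest and smallest eigenvalues of the preconditioned operator bound the form of
  \<open>A\<close> above and below by that of \<open>D\<close>; on a nonzero space their reciprocals
  are \<open>a\<close> and \<open>b\<close>. The relation between \<open>b\<close> and
  \<open>a\<close> is recorded because \<open>local_step\<close> uses it to trade
  \<open>b - a\<close> for a multiple of the step size.\<close>

lemma precond_cond_bounds:
  assumes A: "spd_on VV A" and WV: "W \<subseteq> VV" and fin: "finite_dim W" and D: "spd_on W D"
  obtains a b where "0 < a" "a \<le> b" "b = precond_cond A W D * a"
    "\<And>x. x \<in> W \<Longrightarrow> a * (A x \<bullet> x) \<le> D x \<bullet> x" "\<And>x. x \<in> W \<Longrightarrow> D x \<bullet> x \<le> b * (A x \<bullet> x)"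
proof (cases "W = {0}")
  \<comment> \<open>On the zero space the condition number is 1 by convention and both forms vanish,
    so \<open>a = b = 1\<close> works.\<close>
  case True
  then show thesis
    using linear_map_on_zero[OF spd_on_linear[OF D] finite_dim_subspace[OF fin]]
    by (intro that[of 1 1]) (auto simp: precond_cond_def spectral_cond_def)
next
  case False
  let ?S = "local_op A W"
  let ?T = "\<lambda>x. inv_into W D (?S x)"
  have W: "subspace W"
    using fin by (rule finite_dim_subspace)
  have S: "spd_on W ?S"
    using spd_on_local_op[OF A WV fin] .
  have SA: "?S x \<bullet> x = A x \<bullet> x" if "x \<in> W" for x
    using that by (rule local_op_inner[OF fin])
  define L where "L = {l. \<exists>x\<in>W. x \<noteq> 0 \<and> ?S x = l *\<^sub>R D x}"
  \<comment> \<open>Applying \<open>D\<close> to the eigenvalue equation moves the inverse away: the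
    spectrum is that of a pencil of two symmetric operators, to which the Rayleigh quotient and
    finiteness results apply.\<close>
  have T_iff: "?T x = l *\<^sub>R x \<longleftrightarrow> ?S x = l *\<^sub>R D x" if x: "x \<in> W" for x l
  proof -
    have "?S x \<in> D ` W"
      using local_op_mem[OF fin] spd_on_surj[OF D fin] by metis
    moreover have lx: "l *\<^sub>R x \<in> W" "D (l *\<^sub>R x) = l *\<^sub>R D x"
      using x W by (auto simp: subspace_scale linear_map_on_scale[OF spd_on_linear[OF D]])
    ultimately show ?thesis
      by (metis f_inv_into_f inv_into_f_f spd_on_inj[OF D W])
  qed
  have L: "eigenvalues_on W ?T = L"
    unfolding eigenvalues_on_def L_def using T_iff by blast
  have finL: "finite L"
    unfolding L_def using finite_pencil_eigenvalues[OF fin D] spd_on_sym[OF S] by blast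
  have pos: "l > 0" if "l \<in> L" for l
  proof -
    from that obtain x where x: "x \<in> W" "x \<noteq> 0" "?S x = l *\<^sub>R D x"
      by (auto simp: L_def)
    then have "l * (D x \<bullet> x) > 0"
      using spd_on_pos[OF S x(1,2)] by simp
    then show ?thesis
      using spd_on_pos[OF D x(1,2)] by (simp add: zero_less_mult_iff)
  qed
  obtain l x where l: "x \<in> W" "x \<noteq> 0" "?S x = l *\<^sub>R D x"
      "\<And>y. y \<in> W \<Longrightarrow> ?S y \<bullet> y \<le> l * (D y \<bullet> y)"
    by (rule max_rayleigh_quotient[OF fin False D spd_on_linear[OF S]])
      (use spd_on_sym[OF S] in \<open>blast+\<close>)
  \<comment> \<open>The lower end of the spectrum comes from maximizing the quotient of the negated
    operator; \<open>- m\<close> is then the smallest quotient.\<close>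
  have neg: "linear_map_on W W (\<lambda>x. - ?S x)"
    using spd_on_linear[OF S] subspace_neg[OF W] by (auto simp: linear_map_on_def)
  obtain m z where m: "z \<in> W" "z \<noteq> 0" "- ?S z = m *\<^sub>R D z"
      "\<And>y. y \<in> W \<Longrightarrow> - ?S y \<bullet> y \<le> m * (D y \<bullet> y)"
    by (rule max_rayleigh_quotient[OF fin False D neg]) (use spd_on_sym[OF S] in auto)
  have lL: "l \<in> L"
    using l by (auto simp: L_def)
  have "?S z = (- m) *\<^sub>R D z"
    using m(3) by (metis add.inverse_inverse scaleR_minus_left)
  then have mL: "- m \<in> L"
    using m(1,2) by (auto simp: L_def)
  \<comment> \<open>\<open>l\<close> and \<open>- m\<close> are themselves eigenvalues, so replacing
    them by the extreme ones only weakens the two Rayleigh bounds.\<close>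
  define lM lm where "lM = Max L" and "lm = Min L"
  have "lm \<in> L"
    unfolding lm_def using finL lL by (intro Min_in) auto
  then have "lm > 0" "lm \<le> lM"
    using pos finL by (auto simp: lM_def)
  moreover have "l \<le> lM" "lm \<le> - m"
    using finL lL mL by (auto simp: lM_def lm_def)
  ultimately have ineq: "l \<le> lM" "lm \<le> - m" "lm > 0" "lm \<le> lM"
    by blast+
  have \<kappa>: "precond_cond A W D = lM / lm"
    using False by (simp add: precond_cond_def spectral_cond_def L lM_def lm_def)
  show thesis
  proof (rule that[of "1 / lM" "1 / lm"])
    show "0 < 1 / lM" "1 / lM \<le> 1 / lm" "1 / lm = precond_cond A W D * (1 / lM)"
      using ineq \<kappa> by (auto simp: frac_le)
    fix x assume x: "x \<in> W"
    have Dx: "0 \<le> D x \<bullet> x"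
      using spd_on_nonneg[OF D x] .
    have "A x \<bullet> x \<le> lM * (D x \<bullet> x)"
      using l(4)[OF x] mult_right_mono[OF ineq(1) Dx] SA[OF x] by linarith
    then show "1 / lM * (A x \<bullet> x) \<le> D x \<bullet> x"
      using ineq by (simp add: divide_le_eq mult.commute)
    have "lm * (D x \<bullet> x) \<le> A x \<bullet> x"
      using m(4)[OF x] mult_right_mono[OF ineq(2) Dx] SA[OF x] by simp
    then show "D x \<bullet> x \<le> 1 / lm * (A x \<bullet> x)"
      using ineq by (simp add: le_divide_eq mult.commute)
  qed
qed

section \<open>One local step\<close>

lemma spd_on_op_norm_sq: "spd_on VV A \<Longrightarrow> x \<in> VV \<Longrightarrow> (op_norm A x)\<^sup>2 = A x \<bullet> x"
  using spd_on_nonneg[of VV A x] by (simp add: op_norm_def op_inner_def)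

lemma spd_on_op_norm_nonneg: "spd_on VV A \<Longrightarrow> x \<in> VV \<Longrightarrow> 0 \<le> op_norm A x"
  using spd_on_nonneg[of VV A x] by (simp add: op_norm_def op_inner_def)

lemma op_norm_scale:
  assumes "linear_map_on VV Z A" "x \<in> VV"
  shows "op_norm A (c *\<^sub>R x) = \<bar>c\<bar> * op_norm A x"
proof -
  have "op_norm A (c *\<^sub>R x) = sqrt (c\<^sup>2 * (A x \<bullet> x))"
    using linear_map_on_scale[OF assms] by (simp add: op_norm_def op_inner_def power2_eq_square mult.assoc)
  then show ?thesis
    by (simp add: real_sqrt_mult op_norm_def op_inner_def)
qed

lemma energy_add:
  assumes A: "spd_on VV A" and VV: "subspace VV" and "v \<in> VV" "d \<in> VV"
  shows "energy A f (v + d) = energy A f v + (A v - f) \<bullet> d + 1/2 * (A d \<bullet> d)"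
proof -
  have "A (v + d) = A v + A d"
    using linear_map_on_add[OF spd_on_linear[OF A]] assms by blast
  moreover have "v + d \<in> VV"
    using assms by (simp add: subspace_add)
  ultimately show ?thesis
    using spd_on_sym[OF A \<open>d \<in> VV\<close> \<open>v \<in> VV\<close>] assms
    by (simp add: energy_def spd_on_op_norm_sq[OF A] inner_add_left inner_add_right
        inner_diff_left algebra_simps)
qed

text \<open>Along the line \<open>u + t w\<close> inside \<open>K\<close> the energy is a quadratic
  in \<open>t\<close> with its minimum at 0.\<close>

lemma energy_minimizer_variational:
  assumes A: "spd_on VV A" and VV: "subspace VV" and K: "subspace K" "K \<subseteq> VV"
    and min: "is_arg_min (energy A f) (\<lambda>v. v \<in> K) u" and w: "w \<in> K"
  shows "(A u - f) \<bullet> w = 0"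
proof (rule quadratic_nonneg_imp_zero)
  fix t :: real
  have u: "u \<in> K"
    using min by (simp add: is_arg_min_def)
  have tw: "t *\<^sub>R w \<in> K" "u + t *\<^sub>R w \<in> K"
    using u w K(1) by (auto simp: subspace_add subspace_scale)
  have "energy A f u \<le> energy A f (u + t *\<^sub>R w)"
    using min tw(2) by (auto simp: is_arg_min_def not_less)
  also have "\<dots> = energy A f u + (A u - f) \<bullet> (t *\<^sub>R w) + 1/2 * (A (t *\<^sub>R w) \<bullet> (t *\<^sub>R w))"
    using u tw(1) K(2) by (intro energy_add[OF A VV]) auto
  also have "A (t *\<^sub>R w) = t *\<^sub>R A w"
    using w K(2) by (intro linear_map_on_scale[OF spd_on_linear[OF A]]) auto
  finally show "0 \<le> t * ((A u - f) \<bullet> w) + t\<^sup>2 * (1/2 * (A w \<bullet> w))"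
    by (simp add: power2_eq_square)
qed

text \<open>Polarization, after scaling \<open>x\<close> to the \<open>A\<close>-norm of \<open>y\<close>.\<close>
lemma symmetric_form_bound:
  assumes A: "spd_on VV A" and W: "subspace W" "W \<subseteq> VV"
    and G: "linear_map_on W UNIV G"
    and sym: "\<And>x y. x \<in> W \<Longrightarrow> y \<in> W \<Longrightarrow> G x \<bullet> y = G y \<bullet> x"
    and bound: "\<And>z. z \<in> W \<Longrightarrow> \<bar>G z \<bullet> z\<bar> \<le> c * (A z \<bullet> z)"
    and x: "x \<in> W" and y: "y \<in> W"
  shows "G x \<bullet> y \<le> c * op_norm A x * op_norm A y"
proof (cases "x = 0 \<or> y = 0")
  case True
  then show ?thesis
    using linear_map_on_zero[OF G W(1)] by (auto simp: op_norm_def op_inner_def)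
next
  case False
  have AW: "linear_map_on W UNIV A"
    using spd_on_linear[OF A] W(2) by (auto simp: linear_map_on_def subset_iff)
  define nx ny where "nx = op_norm A x" and "ny = op_norm A y"
  have n: "nx > 0" "ny > 0"
    using spd_on_pos[OF A] x y W(2) False by (auto simp: nx_def ny_def op_norm_def op_inner_def)
  have n2: "A x \<bullet> x = nx\<^sup>2" "A y \<bullet> y = ny\<^sup>2"
    using spd_on_op_norm_sq[OF A] x y W(2) by (auto simp: nx_def ny_def)
  define t where "t = ny / nx"
  define z where "z = t *\<^sub>R x"
  have z: "z \<in> W"
    using x W(1) by (simp add: z_def subspace_scale)
  have Az: "A z = t *\<^sub>R A x" "G z = t *\<^sub>R G x"
    using x by (simp_all add: z_def linear_map_on_scale[OF AW] linear_map_on_scale[OF G])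
  have mem: "z + y \<in> W" "z - y \<in> W"
    using z y W(1) by (simp_all add: subspace_add subspace_diff)
  \<comment> \<open>Polarization needs the bound on both sides: one diagonal value is estimated from
    above, the other from below. The parallelogram identity for \<open>A\<close> then removes the
    cross terms.\<close>
  have "4 * (G z \<bullet> y) = G (z + y) \<bullet> (z + y) - G (z - y) \<bullet> (z - y)"
    using sym[OF z y] z y
    by (simp add: linear_map_on_add[OF G] linear_map_on_diff[OF G W(1)]
        inner_add_left inner_add_right inner_diff_left inner_diff_right)
  also have "\<dots> \<le> c * (A (z + y) \<bullet> (z + y)) + c * (A (z - y) \<bullet> (z - y))"
    using bound[OF mem(1)] bound[OF mem(2)] by linarith
  also have "\<dots> = 2 * c * (A z \<bullet> z + A y \<bullet> y)"
    using z y by (simp add: linear_map_on_add[OF AW] linear_map_on_diff[OF AW W(1)]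
        inner_add_left inner_add_right inner_diff_left inner_diff_right algebra_simps)
  also have "A z \<bullet> z = ny\<^sup>2"
    unfolding Az using n by (simp add: z_def n2(1) t_def power2_eq_square)
  finally have "t * (G x \<bullet> y) \<le> c * ny\<^sup>2"
    by (simp add: Az n2)
  then have "ny * (G x \<bullet> y) \<le> ny * (c * nx * ny)"
    using n by (simp add: t_def divide_le_eq power2_eq_square algebra_simps)
  then show ?thesis
    using n unfolding nx_def[symmetric] ny_def[symmetric] by simp
qed

text \<open>The line search makes the residual \<open>D s - \<alpha> A s\<close> orthogonal to \<open>s\<close>, so only the part of
  \<open>w\<close> that is \<open>A\<close>-orthogonal to \<open>s\<close> contributes, and for it \<open>\<alpha>\<close> may be replaced by \<open>(a + b) / 2\<close>.\<close>
lemma line_search_residual_bound: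
  assumes A: "spd_on VV A" and W: "subspace W" "W \<subseteq> VV" and D: "spd_on W D"
    and ab: "a \<le> b" "\<And>x. x \<in> W \<Longrightarrow> a * (A x \<bullet> x) \<le> D x \<bullet> x"
      "\<And>x. x \<in> W \<Longrightarrow> D x \<bullet> x \<le> b * (A x \<bullet> x)"
    and s: "s \<in> W" "s \<noteq> 0" and w: "w \<in> W"
  shows "(D s - ((D s \<bullet> s) / (A s \<bullet> s)) *\<^sub>R A s) \<bullet> w \<le> (b - a) / 2 * op_norm A s * op_norm A w"
proof -
  define \<alpha> \<beta> where "\<alpha> = (D s \<bullet> s) / (A s \<bullet> s)" and "\<beta> = (A s \<bullet> w) / (A s \<bullet> s)"
  define z where "z = w - \<beta> *\<^sub>R s"
  have AW: "linear_map_on W UNIV A"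
    using spd_on_linear[OF A] W(2) by (auto simp: linear_map_on_def subset_iff)
  have DW: "linear_map_on W UNIV D"
    using spd_on_linear[OF D] by (auto simp: linear_map_on_def)
  have As: "A s \<bullet> s > 0"
    using spd_on_pos[OF A] s W(2) by blast
  have z: "z \<in> W"
    using s w W(1) by (simp add: z_def subspace_diff subspace_scale)
  have sz: "A s \<bullet> z = 0"
    using As by (simp add: z_def \<beta>_def inner_diff_right)
  then have zs: "A z \<bullet> s = 0"
    using spd_on_sym[OF A, of s z] s z W(2) by auto
  have w_eq: "w = z + \<beta> *\<^sub>R s"
    by (simp add: z_def)
  \<comment> \<open>Pythagoras in the \<open>A\<close>-inner product: removing the component along
    \<open>s\<close> does not increase the \<open>A\<close>-norm.\<close>
  have "A w \<bullet> w = A z \<bullet> z + \<beta>\<^sup>2 * (A s \<bullet> s)"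
    unfolding w_eq using z s W(1) sz zs
    by (simp add: linear_map_on_add[OF AW] linear_map_on_scale[OF AW] subspace_scale
        inner_add_left inner_add_right power2_eq_square)
  then have zw: "op_norm A z \<le> op_norm A w"
    using As by (simp add: op_norm_def op_inner_def)
  \<comment> \<open>Subtracting the midpoint of \<open>a\<close> and \<open>b\<close> turns the
    one-sided bounds on \<open>D\<close> into a bound symmetric about 0 with constant
    \<open>(b - a) / 2\<close>.\<close>
  let ?G = "\<lambda>x. D x - ((a + b) / 2) *\<^sub>R A x"
  have "(D s - \<alpha> *\<^sub>R A s) \<bullet> w = D s \<bullet> z"
    unfolding w_eq using As sz
    by (simp add: inner_diff_left inner_add_right \<alpha>_def)
  also have "\<dots> = ?G s \<bullet> z"
    using sz by (simp add: inner_diff_left)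
  also have "\<dots> \<le> (b - a) / 2 * op_norm A s * op_norm A z"
  proof (rule symmetric_form_bound[OF A W, where G = ?G])
    show "linear_map_on W UNIV ?G"
      using AW DW by (auto simp: linear_map_on_def algebra_simps)
    show "?G x \<bullet> y = ?G y \<bullet> x" if "x \<in> W" "y \<in> W" for x y
      using spd_on_sym[OF A, of x y] spd_on_sym[OF D that] that W(2) by (auto simp: inner_diff_left)
    show "\<bar>?G x \<bullet> x\<bar> \<le> (b - a) / 2 * (A x \<bullet> x)" if "x \<in> W" for x
      using ab(2)[OF that] ab(3)[OF that] by (simp add: inner_diff_left abs_le_iff field_simps)
  qed (use s z in auto)
  also have "\<dots> \<le> (b - a) / 2 * op_norm A s * op_norm A w"
    using zw ab(1) spd_on_op_norm_nonneg[OF A, of s] s W(2)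
    by (intro mult_left_mono mult_nonneg_nonneg) auto
  finally show ?thesis
    unfolding \<alpha>_def .
qed

text \<open>Tested with \<open>w\<close> in the local kernel, the multiplier term becomes
  \<open>p \<bullet> B w = 0\<close>. What remains is the Galerkin equation for \<open>D\<close> on
  the kernel, and the multiplier never appears again.\<close>

lemma local_saddle_solution_galerkin:
  assumes B: "linear_map_on VV UNIV B" and W: "W \<subseteq> VV" "finite_dim W"
    and sol: "local_saddle_solution B W D r s p"
  shows "s \<in> kernel_on W B" "w \<in> kernel_on W B \<Longrightarrow> D s \<bullet> w = r \<bullet> w"
proof -
  let ?Z = "B ` W"
  have BW: "linear_map_on W UNIV B"
    using B W(1) by (auto simp: linear_map_on_def subset_iff)
  have Z: "subspace ?Z"
    by (rule finite_dim_subspace[OF finite_dim_image[OF BW W(2)]])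
  have eq: "local_op B ?Z x = B x" if "x \<in> W" for x
    using that by (intro local_op_range Z) auto
  have lin: "linear_map_on W UNIV (local_op B ?Z)"
    using BW finite_dim_subspace[OF W(2)]
    by (simp add: linear_map_on_def eq subspace_add subspace_scale)
  have s: "s \<in> W" "D s + adjoint_on W (local_op B ?Z) p = r" "local_op B ?Z s = 0"
    using sol by (auto simp: local_saddle_solution_def Let_def)
  then show "s \<in> kernel_on W B"
    using eq by (simp add: kernel_on_def)
  assume "w \<in> kernel_on W B"
  then have "adjoint_on W (local_op B ?Z) p \<bullet> w = 0"
    using adjoint_on_inner[OF W(2) lin, of w p] eq by (simp add: kernel_on_def)
  then show "D s \<bullet> w = r \<bullet> w"
    using s(2) by (auto simp: inner_add_left)
qed

lemma subspace_kernel_on: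
  assumes "linear_map_on VV UNIV B" "subspace W" "W \<subseteq> VV"
  shows "subspace (kernel_on W B)"
proof -
  have "B 0 = 0"
    using linear_map_on_zero[OF assms(1)] linear_map_on_scale[OF assms(1), of 0 0] assms(2,3)
      subspace_0[OF assms(2)] by auto
  with assms show ?thesis
    unfolding subspace_def kernel_on_def
    by (auto simp: linear_map_on_add[OF assms(1)] linear_map_on_scale[OF assms(1)] subset_iff)
qed

text \<open>Follows from \<open>a \<le> b = \<kappa> a\<close> with \<open>a > 0\<close>; it keeps
  the factor \<open>\<kappa> - 1\<close> nonnegative in later monotonicity steps.\<close>

lemma precond_cond_ge_1:
  assumes "spd_on VV A" "W \<subseteq> VV" "finite_dim W" "spd_on W D"
  shows "1 \<le> precond_cond A W D"
proof -
  obtain a b where "0 < a" "a \<le> b" "b = precond_cond A W D * a"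
    by (rule precond_cond_bounds[OF assms]) blast
  then show ?thesis
    using mult_le_cancel_right_pos[of a 1 "precond_cond A W D"] by simp
qed

text \<open>On the local kernel the residual acts as \<open>D s\<close>. Taking \<open>s\<close>
  itself as test vector shows that \<open>\<alpha>\<close> is the exact minimizing step, which gives
  the energy drop; other test vectors leave the residual treated in
  \<open>line_search_residual_bound\<close>.\<close>

lemma local_step:
  assumes A: "spd_on VV A" and VV: "subspace VV" and B: "linear_map_on VV UNIV B"
    and W: "W \<subseteq> VV" "finite_dim W" and D: "spd_on W D" and v: "v \<in> VV"
    and sol: "local_saddle_solution B W D (orth_proj W (f - A v)) s p"
    and e: "e = line_search_update A (orth_proj W (f - A v)) s"
  shows "e \<in> kernel_on W B"
    and "energy A f (v + e) = energy A f v - 1/2 * (op_norm A e)\<^sup>2"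
    and "w \<in> kernel_on W B \<Longrightarrow> (f - A (v + e)) \<bullet> w
           \<le> (precond_cond A W D - 1) / 2 * op_norm A e * op_norm A w"
proof -
  let ?r = "orth_proj W (f - A v)"
  note Al = spd_on_linear[OF A] and Ws = finite_dim_subspace[OF W(2)]
  have sK: "s \<in> kernel_on W B"
    using local_saddle_solution_galerkin(1)[OF B W sol] .
  then have s: "s \<in> W" "s \<in> VV"
    using W(1) by (auto simp: kernel_on_def)
  have gal: "(f - A v) \<bullet> x = D s \<bullet> x" if "x \<in> kernel_on W B" for x
    using local_saddle_solution_galerkin(2)[OF B W sol that] orth_proj_inner[OF W(2), of x "f - A v"] that
    by (auto simp: kernel_on_def)
  have rs: "?r \<bullet> s = D s \<bullet> s"
    using local_saddle_solution_galerkin(2)[OF B W sol sK] by simp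
  define \<alpha> where "\<alpha> = (D s \<bullet> s) / (A s \<bullet> s)"
  \<comment> \<open>This includes \<open>s = 0\<close>, where the update is 0 by definition and
    \<open>\<alpha> *\<^sub>R s\<close> is 0 as well.\<close>
  have e_eq: "e = \<alpha> *\<^sub>R s"
    using e rs by (simp add: line_search_update_def \<alpha>_def)
  show eK: "e \<in> kernel_on W B"
    unfolding e_eq using subspace_kernel_on[OF B Ws W(1)] sK by (rule subspace_scale)
  then have eV: "e \<in> VV"
    using W(1) by (auto simp: kernel_on_def)
  have Ae: "A e = \<alpha> *\<^sub>R A s"
    unfolding e_eq by (rule linear_map_on_scale[OF Al s(2)])
  have Ds: "D s \<bullet> s = \<alpha> * (A s \<bullet> s)"
    using spd_on_pos[OF A s(2)] by (cases "s = 0") (auto simp: \<alpha>_def)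
  \<comment> \<open>Exactness of the line search makes the linear term of the energy minus twice the
    quadratic one, so together they lower the energy by half the squared norm of
    \<open>e\<close>.\<close>
  have "(A v - f) \<bullet> e = - (\<alpha> * (D s \<bullet> s))"
    using gal[OF sK] by (simp add: e_eq inner_diff_left algebra_simps)
  also have "\<dots> = - (A e \<bullet> e)"
    unfolding Ae by (simp add: e_eq Ds)
  finally show "energy A f (v + e) = energy A f v - 1/2 * (op_norm A e)\<^sup>2"
    using energy_add[OF A VV v eV, of f] spd_on_op_norm_sq[OF A eV] by simp
  assume wK: "w \<in> kernel_on W B"
  then have w: "w \<in> W" "w \<in> VV"
    using W(1) by (auto simp: kernel_on_def)
  have res: "(f - A (v + e)) \<bullet> w = (D s - \<alpha> *\<^sub>R A s) \<bullet> w"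
    using gal[OF wK] by (simp add: linear_map_on_add[OF Al v eV] Ae inner_diff_left inner_add_left)
  show "(f - A (v + e)) \<bullet> w \<le> (precond_cond A W D - 1) / 2 * op_norm A e * op_norm A w"
  proof (cases "s = 0")
    case True
    then show ?thesis
      unfolding res using linear_map_on_zero[OF Al VV] linear_map_on_zero[OF spd_on_linear[OF D] Ws]
      by (simp add: e_eq op_norm_def op_inner_def)
  next
    case False
    obtain a b where ab: "0 < a" "a \<le> b" "b = precond_cond A W D * a"
      "\<And>x. x \<in> W \<Longrightarrow> a * (A x \<bullet> x) \<le> D x \<bullet> x" "\<And>x. x \<in> W \<Longrightarrow> D x \<bullet> x \<le> b * (A x \<bullet> x)"
      by (rule precond_cond_bounds[OF A W D]) blast
    \<comment> \<open>\<open>\<alpha>\<close> is a Rayleigh quotient of \<open>D\<close> relative to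
      \<open>A\<close>, hence at least \<open>a\<close>. So \<open>b - a = (\<kappa> - 1) a\<close>
      is at most \<open>(\<kappa> - 1) \<alpha>\<close>, and \<open>\<alpha>\<close> times the norm
      of \<open>s\<close> is the norm of \<open>e\<close>.\<close>
    have "a \<le> \<alpha>"
      using ab(4)[OF s(1)] spd_on_pos[OF A s(2) False] by (simp add: \<alpha>_def le_divide_eq)
    then have "(precond_cond A W D - 1) * a \<le> (precond_cond A W D - 1) * \<alpha>"
      using precond_cond_ge_1[OF A W D] by (intro mult_left_mono) auto
    then have "b - a \<le> (precond_cond A W D - 1) * \<alpha>"
      using ab(3) by (simp add: algebra_simps)
    then have "(b - a) / 2 * (op_norm A s * op_norm A w)
        \<le> (precond_cond A W D - 1) * \<alpha> / 2 * (op_norm A s * op_norm A w)"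
      using spd_on_op_norm_nonneg[OF A] s(2) w(2) by (intro mult_right_mono) auto
    also have "\<dots> = (precond_cond A W D - 1) / 2 * op_norm A e * op_norm A w"
      using \<open>a \<le> \<alpha>\<close> ab(1) by (simp add: e_eq op_norm_scale[OF Al s(2)])
    finally show ?thesis
      unfolding res
      using line_search_residual_bound[OF A Ws W(1) D ab(2,4,5) s(1) False w(1)]
      by (simp add: \<alpha>_def mult.assoc)
  qed
qed

section \<open>Convergence\<close>

text \<open>Used with \<open>X\<close> and \<open>X + S\<close> as twice the energy errors after and
  before the sweep: an error controlled by the decrease \<open>S\<close> is a fixed fraction
  \<open>c / (1 + c)\<close> of the earlier error.\<close>

lemma contraction_factor:
  fixes X S c :: real
  assumes "0 \<le> c" "X \<le> c * S"
  shows "X \<le> (1 - 1 / (1 + c)) * (X + S)"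
proof -
  have "(1 - 1 / (1 + c)) * (X + S) - X = (c * S - X) / (1 + c)"
    using assms(1) by (simp add: field_simps)
  then show ?thesis
    using assms by (smt (verit) divide_nonneg_nonneg)
qed

theorem theorem5p5:
  fixes VV :: "'h::{real_inner, complete_space} set"
    and A :: "'h \<Rightarrow> 'h"
    and B :: "'h \<Rightarrow> 'p::{real_inner, complete_space}"
    and f :: 'h
    and N :: nat
    and V :: "nat \<Rightarrow> 'h set"
    and D :: "nat \<Rightarrow> 'h \<Rightarrow> 'h"
    and C\<^sub>A C\<^sub>S :: real
    and u u\<^sub>k u\<^sub>k\<^sub>1 :: 'h
  defines "K \<equiv> kernel_on VV B"
    and "K\<^sub>i \<equiv> \<lambda>i. kernel_on (V i) B"
    and "\<rho> \<equiv> 1 - 1 / (1 + C\<^sub>A * (sqrt C\<^sub>S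
              + 1/2 * (Max ((\<lambda>i. precond_cond A (V i) (D i)) ` {1..N}) - 1))\<^sup>2)"
  assumes "subspace VV" and "closed VV"
    and "spd_on VV A"
    and "bounded_linear_map_on VV B"
    and "N \<ge> 1"
    and "\<And>i. i \<in> {1..N} \<Longrightarrow> subspace (V i) \<and> V i \<subseteq> VV \<and> finite_dim (V i)"
    and "VV = (\<Sum>i=1..N. V i)"
    and "K = (\<Sum>i=1..N. K\<^sub>i i)"
    and "\<And>i. i \<in> {1..N} \<Longrightarrow> spd_on (V i) (D i)"
    and "C\<^sub>A > 0" and "C\<^sub>S > 0"
    and SD: "\<And>v. v \<in> K \<Longrightarrow>
          \<exists>w. (\<forall>i\<in>{1..N}. w i \<in> K\<^sub>i i) \<and> v = (\<Sum>i=1..N. w i) \<and>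
              (\<Sum>i=1..N. (op_norm A (w i))\<^sup>2) \<le> C\<^sub>A * (op_norm A v)\<^sup>2"
    and SCS: "\<And>x y. (\<And>i. i \<in> {1..N} \<Longrightarrow> x i \<in> K\<^sub>i i) \<Longrightarrow> (\<And>j. j \<in> {1..N} \<Longrightarrow> y j \<in> K\<^sub>i j) \<Longrightarrow>
          (\<Sum>i=1..N. \<Sum>j=i+1..N. op_inner A (x i) (y j))
            \<le> sqrt C\<^sub>S * sqrt (\<Sum>i=1..N. (op_norm A (x i))\<^sup>2)
                       * sqrt (\<Sum>j=1..N. (op_norm A (y j))\<^sup>2)"
    and "is_arg_min (energy A f) (\<lambda>v. v \<in> K) u"
    and "u\<^sub>k \<in> K"
    and "inexact_sso_step N V A B D f u\<^sub>k u\<^sub>k\<^sub>1"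
  shows "energy A f u\<^sub>k\<^sub>1 - energy A f u \<le> \<rho> * (energy A f u\<^sub>k - energy A f u)"
proof -
  note VV = \<open>subspace VV\<close> and A = \<open>spd_on VV A\<close>
  note Al = spd_on_linear[OF A]
  have B: "linear_map_on VV UNIV B"
    using \<open>bounded_linear_map_on VV B\<close> by (simp add: bounded_linear_map_on_def)
  have V: "V i \<subseteq> VV" "finite_dim (V i)" and D: "spd_on (V i) (D i)" if "i \<in> {1..N}" for i
    using that assms(9,12) by auto
  have K: "subspace K" "K \<subseteq> VV"
    using subspace_kernel_on[OF B VV] by (auto simp: K_def kernel_on_def)
  have KiK: "K\<^sub>i i \<subseteq> K" and Ki: "subspace (K\<^sub>i i)" if "i \<in> {1..N}" for i
    using V[OF that] subspace_kernel_on[OF B finite_dim_subspace]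
    by (auto simp: K_def K\<^sub>i_def kernel_on_def)
  have uK: "u \<in> K"
    using \<open>is_arg_min (energy A f) (\<lambda>v. v \<in> K) u\<close> by (simp add: is_arg_min_def)

  \<comment> \<open>The intermediate iterates and their corrections\<close>
  obtain v s p where v0: "v 0 = u\<^sub>k" and vN: "v N = u\<^sub>k\<^sub>1"
    and step: "\<And>i. i \<in> {1..N} \<Longrightarrow>
       local_saddle_solution B (V i) (D i) (orth_proj (V i) (f - A (v (i - 1)))) (s i) (p i) \<and>
       v i = v (i - 1) + line_search_update A (orth_proj (V i) (f - A (v (i - 1)))) (s i)"
    using \<open>inexact_sso_step N V A B D f u\<^sub>k u\<^sub>k\<^sub>1\<close> unfolding inexact_sso_step_def Let_def by blast
  \<comment> \<open>At \<open>i = 0\<close> truncated subtraction gives \<open>e 0 = 0\<close>, so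
    \<open>v_eq\<close> holds for every index.\<close>
  define e where "e i = v i - v (i - 1)" for i
  define \<kappa> where "\<kappa> = Max ((\<lambda>i. precond_cond A (V i) (D i)) ` {1..N})"
  have v_eq: "v (i - 1) + e i = v i" for i
    by (simp add: e_def)
  \<comment> \<open>Feasibility of the previous iterate is an explicit premise because the first
    conclusion feeds the induction \<open>vK\<close> that establishes feasibility.\<close>
  have substep: "e i \<in> K\<^sub>i i"
      "energy A f (v i) = energy A f (v (i - 1)) - 1/2 * (op_norm A (e i))\<^sup>2"
      "w \<in> K\<^sub>i i \<Longrightarrow> (f - A (v i)) \<bullet> w
        \<le> (precond_cond A (V i) (D i) - 1) / 2 * op_norm A (e i) * op_norm A w"
    if i: "i \<in> {1..N}" and "v (i - 1) \<in> K" for i w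
  proof -
    have prev: "v (i - 1) \<in> VV"
      using that(2) K(2) by blast
    have sol: "local_saddle_solution B (V i) (D i) (orth_proj (V i) (f - A (v (i - 1)))) (s i) (p i)"
      and ei: "e i = line_search_update A (orth_proj (V i) (f - A (v (i - 1)))) (s i)"
      using step[OF i] by (auto simp: e_def)
    note local_step[OF A VV B V[OF i] D[OF i] prev sol ei, unfolded v_eq]
    then show "e i \<in> K\<^sub>i i"
        "energy A f (v i) = energy A f (v (i - 1)) - 1/2 * (op_norm A (e i))\<^sup>2"
        "w \<in> K\<^sub>i i \<Longrightarrow> (f - A (v i)) \<bullet> w
          \<le> (precond_cond A (V i) (D i) - 1) / 2 * op_norm A (e i) * op_norm A w"
      unfolding K\<^sub>i_def by blast+
  qed
  have vK: "v i \<in> K" if "i \<le> N" for i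
    using that
  proof (induction i)
    case 0
    then show ?case
      using v0 \<open>u\<^sub>k \<in> K\<close> by simp
  next
    case (Suc i)
    then have "e (Suc i) \<in> K"
      using substep(1)[of "Suc i"] KiK[of "Suc i"] by auto
    then show ?case
      using v_eq[of "Suc i"] subspace_add[OF K(1)] Suc by (metis diff_Suc_1 Suc_leD)
  qed
  have prev: "v (i - 1) \<in> K" if "i \<in> {1..N}" for i
    using that by (intro vK) auto
  have eK: "e i \<in> K\<^sub>i i" if "i \<in> {1..N}" for i
    using substep(1)[OF that prev[OF that]] .
  have eV: "e i \<in> VV" if "i \<in> {1..N}" for i
    using eK[OF that] KiK[OF that] K(2) by blast

  \<comment> \<open>Energy decrease over the sweep\<close>
  define S where "S = (\<Sum>i=1..N. (op_norm A (e i))\<^sup>2)"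
  have decrease: "energy A f u\<^sub>k = energy A f u\<^sub>k\<^sub>1 + 1/2 * S"
  proof -
    have "energy A f (v N) - energy A f (v 0) = (\<Sum>i=1..N. energy A f (v i) - energy A f (v (i - 1)))"
      using sum_telescope''[of 0 N "\<lambda>i. energy A f (v i)"] by simp
    also have "\<dots> = (\<Sum>i=1..N. - (1/2 * (op_norm A (e i))\<^sup>2))"
      using substep(2) prev by (intro sum.cong) auto
    also have "\<dots> = - (1/2 * S)"
      by (simp add: S_def sum_negf sum_divide_distrib)
    finally show ?thesis
      using v0 vN by simp
  qed

  \<comment> \<open>Energy error as an \<open>A\<close>-norm\<close>
  define d where "d = u - u\<^sub>k\<^sub>1"
  have vNK: "u\<^sub>k\<^sub>1 \<in> K"
    using vK[of N] vN by simp
  have dK: "d \<in> K"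
    using uK vNK K(1) by (simp add: d_def subspace_diff)
  have dV: "d \<in> VV" and uV: "u \<in> VV" and vNV: "u\<^sub>k\<^sub>1 \<in> VV"
    using dK uK vNK K(2) by auto
  have opt: "(A u - f) \<bullet> d = 0"
    using energy_minimizer_variational[OF A VV K \<open>is_arg_min (energy A f) (\<lambda>v. v \<in> K) u\<close> dK] .
  define X where "X = (op_norm A d)\<^sup>2"
  have X: "X = A d \<bullet> d"
    using spd_on_op_norm_sq[OF A dV] by (simp add: X_def)
  \<comment> \<open>The energy is expanded about \<open>u\<close>, where the linear term vanishes by
    optimality.\<close>
  have error: "energy A f u\<^sub>k\<^sub>1 = energy A f u + 1/2 * X"
  proof -
    have md: "A (- d) = - A d"
      using linear_map_on_scale[OF Al dV, of "-1"] by simp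
    have "energy A f (u + - d) = energy A f u + (A u - f) \<bullet> (- d) + 1/2 * (A (- d) \<bullet> (- d))"
      by (intro energy_add[OF A VV uV] subspace_neg VV dV)
    then show ?thesis
      using opt by (simp add: md X) (simp add: d_def)
  qed

  \<comment> \<open>Stable decomposition of the final error\<close>
  obtain w where w: "\<And>i. i \<in> {1..N} \<Longrightarrow> w i \<in> K\<^sub>i i" "d = (\<Sum>i=1..N. w i)"
      "(\<Sum>i=1..N. (op_norm A (w i))\<^sup>2) \<le> C\<^sub>A * X"
    using SD[OF dK] unfolding X_def by blast
  have wV: "w i \<in> VV" if "i \<in> {1..N}" for i
    using w(1)[OF that] KiK[OF that] K(2) by blast
  have \<kappa>: "precond_cond A (V i) (D i) \<le> \<kappa>" if "i \<in> {1..N}" for i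
    unfolding \<kappa>_def using that by (intro Max_ge) auto
  \<comment> \<open>Any index would do: the maximum of the condition numbers inherits the lower
    bound 1 from a single one of them.\<close>
  have "1 \<in> {1..N}"
    using \<open>N \<ge> 1\<close> by simp
  then have \<kappa>1: "1 \<le> \<kappa>"
    using precond_cond_ge_1[OF A V D] \<kappa>[of 1] order_trans by blast

  define M where "M = sqrt C\<^sub>S + 1/2 * (\<kappa> - 1)"
  have M: "M \<ge> 0"
    using \<open>C\<^sub>S > 0\<close> \<kappa>1 by (simp add: M_def)
  define Sw where "Sw = (\<Sum>i=1..N. (op_norm A (w i))\<^sup>2)"
  \<comment> \<open>The final residual is the residual after the \<open>i\<close>-th substep minus
    the effect of the corrections with \<open>j > i\<close>. The first part has the local bound; the
    second is kept for (SCS). The minus sign is put on \<open>w i\<close> because (SCS) bounds the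
    double sum only from above. The absolute values match the form of Cauchy-Schwarz for sums used
    below.\<close>
  have summand: "(f - A u\<^sub>k\<^sub>1) \<bullet> w i \<le> (\<kappa> - 1) / 2 * (\<bar>op_norm A (e i)\<bar> * \<bar>op_norm A (w i)\<bar>)
      + (\<Sum>j=i+1..N. op_inner A (- w i) (e j))" if i: "i \<in> {1..N}" for i
  proof -
    have "(\<Sum>j=i+1..N. e j) = v N - v i"
      unfolding e_def using sum_telescope''[of i N v] i by simp
    then have "A u\<^sub>k\<^sub>1 = A (v i + (\<Sum>j=i+1..N. e j))"
      using vN by simp
    also have "\<dots> = A (v i) + (\<Sum>j=i+1..N. A (e j))"
    proof -
      have ej: "e j \<in> VV" if "j \<in> {i+1..N}" for j
        using that by (intro eV) auto
      then have "(\<Sum>j=i+1..N. e j) \<in> VV"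
        by (intro subspace_sum VV)
      moreover have "v i \<in> VV"
        using vK[of i] i K(2) by auto
      ultimately show ?thesis
        using linear_map_on_add[OF Al] linear_map_on_sum[OF Al VV, of "{i+1..N}" e] ej by simp
    qed
    finally have "(f - A u\<^sub>k\<^sub>1) \<bullet> w i = (f - A (v i)) \<bullet> w i - (\<Sum>j=i+1..N. A (e j) \<bullet> w i)"
      by (simp add: inner_diff_left inner_add_left inner_sum_left)
    also have "(\<Sum>j=i+1..N. A (e j) \<bullet> w i) = - (\<Sum>j=i+1..N. op_inner A (- w i) (e j))"
      unfolding sum_negf[symmetric]
    proof (intro sum.cong refl)
      fix j assume "j \<in> {i+1..N}"
      then show "A (e j) \<bullet> w i = - op_inner A (- w i) (e j)"
        using spd_on_sym[OF A eV[of j] wV[OF i]] linear_map_on_scale[OF Al wV[OF i], of "-1"]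
        by (simp add: op_inner_def)
    qed
    finally have "(f - A u\<^sub>k\<^sub>1) \<bullet> w i
        = (f - A (v i)) \<bullet> w i + (\<Sum>j=i+1..N. op_inner A (- w i) (e j))"
      by simp
    moreover have "(f - A (v i)) \<bullet> w i
        \<le> (precond_cond A (V i) (D i) - 1) / 2 * (op_norm A (e i) * op_norm A (w i))"
      using substep(3)[OF i prev[OF i] w(1)[OF i]] by (simp add: mult.assoc)
    \<comment> \<open>The individual condition number is replaced by the maximum so that a common
      factor can leave the sum over \<open>i\<close>.\<close>
    moreover have "\<dots> \<le> (\<kappa> - 1) / 2 * (op_norm A (e i) * op_norm A (w i))"
      using \<kappa>[OF i] spd_on_op_norm_nonneg[OF A] eV[OF i] wV[OF i] by (intro mult_right_mono) auto
    ultimately show ?thesis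
      using spd_on_op_norm_nonneg[OF A eV[OF i]] spd_on_op_norm_nonneg[OF A wV[OF i]] by simp
  qed
  \<comment> \<open>By optimality \<open>A u\<close> may be replaced by \<open>f\<close> when tested
    with \<open>d\<close>, which turns the squared error into the final residual tested with the
    error.\<close>
  have "X = (f - A u\<^sub>k\<^sub>1) \<bullet> d"
    using opt unfolding X by (simp add: d_def linear_map_on_diff[OF Al VV uV vNV] inner_diff_left)
  also have "\<dots> = (\<Sum>i=1..N. (f - A u\<^sub>k\<^sub>1) \<bullet> w i)"
    by (subst w(2)) (simp add: inner_sum_right)
  also have "\<dots> \<le> (\<Sum>i=1..N. (\<kappa> - 1) / 2 * (\<bar>op_norm A (e i)\<bar> * \<bar>op_norm A (w i)\<bar>)
      + (\<Sum>j=i+1..N. op_inner A (- w i) (e j)))"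
    by (intro sum_mono summand)
  also have "\<dots> = (\<kappa> - 1) / 2 * (\<Sum>i=1..N. \<bar>op_norm A (e i)\<bar> * \<bar>op_norm A (w i)\<bar>)
      + (\<Sum>i=1..N. \<Sum>j=i+1..N. op_inner A (- w i) (e j))"
    by (simp only: sum.distrib sum_distrib_left)
  \<comment> \<open>Cauchy-Schwarz handles the diagonal sum and (SCS) the strictly upper triangular
    one; both yield the same product of square roots, so the constants add up to
    \<open>M\<close>.\<close>
  also have "\<dots> \<le> (\<kappa> - 1) / 2 * (sqrt S * sqrt Sw) + sqrt C\<^sub>S * sqrt Sw * sqrt S"
  proof (intro add_mono mult_left_mono)
    show "(\<Sum>i=1..N. \<bar>op_norm A (e i)\<bar> * \<bar>op_norm A (w i)\<bar>) \<le> sqrt S * sqrt Sw"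
      using L2_set_mult_ineq[of "\<lambda>i. op_norm A (e i)" "\<lambda>i. op_norm A (w i)" "{1..N}"]
      by (simp add: L2_set_def S_def Sw_def)
    have "(\<Sum>i=1..N. (op_norm A (- w i))\<^sup>2) = Sw"
      unfolding Sw_def using op_norm_scale[OF Al wV, of _ "-1"] by (intro sum.cong) auto
    moreover have "- w i \<in> K\<^sub>i i" if "i \<in> {1..N}" for i
      using w(1)[OF that] Ki[OF that] by (simp add: subspace_neg)
    ultimately show "(\<Sum>i=1..N. \<Sum>j=i+1..N. op_inner A (- w i) (e j)) \<le> sqrt C\<^sub>S * sqrt Sw * sqrt S"
      using SCS[of "\<lambda>i. - w i" e] eK by (simp add: S_def)
  qed (use \<kappa>1 in auto)
  also have "\<dots> = M * (sqrt S * sqrt Sw)"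
    by (simp add: M_def algebra_simps)
  finally have X_le: "X \<le> M * (sqrt S * sqrt Sw)" .
  have S0: "S \<ge> 0" "Sw \<ge> 0" "X \<ge> 0"
    by (auto simp: S_def Sw_def X_def intro: sum_nonneg)
  \<comment> \<open>Squaring removes the roots, and (SD) bounds \<open>Sw\<close> by a multiple of
    \<open>X\<close>; one factor \<open>X\<close> then cancels, which is why \<open>X = 0\<close> is
    treated apart.\<close>
  have "X \<le> C\<^sub>A * M\<^sup>2 * S"
  proof (cases "X = 0")
    case False
    have "X\<^sup>2 \<le> (M * (sqrt S * sqrt Sw))\<^sup>2"
      using X_le S0(3) by (rule power_mono)
    also have "\<dots> = M\<^sup>2 * S * Sw"
      using S0 by (simp add: power_mult_distrib)
    also have "\<dots> \<le> M\<^sup>2 * S * (C\<^sub>A * X)"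
      using w(3) S0 unfolding Sw_def by (intro mult_left_mono) auto
    finally have "X * X \<le> C\<^sub>A * M\<^sup>2 * S * X"
      by (simp add: power2_eq_square mult_ac)
    then show ?thesis
      using False S0(3) by simp
  qed (use S0 \<open>C\<^sub>A > 0\<close> in simp)
  \<comment> \<open>By \<open>error\<close> and \<open>decrease\<close>, \<open>X\<close> is twice
    the energy error after the sweep and \<open>X + S\<close> twice the error before it.\<close>
  then have "X \<le> (1 - 1 / (1 + C\<^sub>A * M\<^sup>2)) * (X + S)"
    using \<open>C\<^sub>A > 0\<close> by (intro contraction_factor) auto
  also have "1 - 1 / (1 + C\<^sub>A * M\<^sup>2) = \<rho>"
    by (simp add: \<rho>_def M_def \<kappa>_def)
  finally show ?thesis
    using decrease error by (simp add: algebra_simps)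
qed

end
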